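(* Let $D\subseteq\mathbb N$, let $m\ge 1$ and let $\alpha$ be a natural number or $\omega$ with $1<2m<\alpha\le\omega$. Let $\chi_D$ be the characteristic function of $D$ and $\rho_D:\mathbb N\to\mathcal P^*\mathcal P(\mathbb N)$, $\rho_D(n)=\{\{\chi_D(n)\}\}$. If $G_{\rho_D}\le_L G_{O^\alpha_m}$, then $D$ is recursive.
   Context: Notation: $ex$ is the (possibly undefined) result of applying the $e$-th partial recursive function to $x$; $\langle\cdot,\ldots\rangle$ is a standard recursive coding of finite sequences. For $A,B\subseteq\mathbb N$: $A\wedge B=\{\langle a,b\rangle\mid a\in A,b\in B\}$, $A\to B=\{e\mid\forall a\in A\ (ea\text{ defined and in }B)\}$. For $f,g:\mathcal P(\mathbb N)\to\mathcal P(\mathbb N)$: $f\le g$ means $\bigcap_{p\subseteq\mathbb N}(f(p)\to g(p))\neq\emptyset$; $L(g)(p)=\bigcap_{q\subseteq\mathbb N}\big(((p\to q)\wedge(g(q)\to q))\to q\big)$; $f\le_L g$ means $f\le L(g)$. For nonempty $B\subseteq\mathbb N$ and $\theta:B\to\mathcal P^*\mathcal P(\mathbb N)$ (nonempty families of subsets), $G_\theta(p)=\{\langle n,e\rangle\mid n\in B,\ \exists A\in\theta(n)\,(e\in A\to p)\}$; for a single nonempty family ${\cal A}$, $G_{\cal A}(p)=\bigcup_{A\in{\cal A}}(A\to p)$. Identify a finite $\alpha$ with $\{1,\ldots,\alpha\}$ and $\omega$ with $\mathbb N$; for $m\le\alpha$, $O^\alpha_m=\{X\subseteq\alpha\mid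 |\alpha\setminus X|=m\}$. *)

theory Defs
  imports Main "HOL-Library.Nat_Bijection" "HOL-Library.Extended_Nat"
    "HOL-Library.Indicator_Function"
begin

section \<open>Partial recursive functions and their numbering\<close>

text \<open>
  Programs for the partial recursive functions of arbitrary arity, in Kleene's sense: initial
  functions, composition, primitive recursion and minimisation. Argument tuples are lists and
  arities are not tracked syntactically: a subprogram that meets a tuple of unsuitable length
  diverges.
  On each fixed arity the programs compute exactly the partial recursive functions.
\<close>

datatype recf =
    Zero
  | Succ
  | Proj nat
  | Comp recf "recf list"
  | Prec recf recf
  | Mu recf

text \<open>
  The value \<open>None\<close> means divergence. A composition converges only if all inner functions do
  (strictness), recursion is on the first argument, and \<open>Mu f\<close> at \<open>xs\<close> is the least \<open>n\<close> with
  \<open>f (n, xs) = 0\<close>, where in addition \<open>f (i, xs)\<close> must be defined for all \<open>i < n\<close>.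
\<close>

primrec eval :: "recf \<Rightarrow> nat list \<Rightarrow> nat option" where
  "eval Zero = (\<lambda>xs. Some 0)"
| "eval Succ = (\<lambda>xs. case xs of [x] \<Rightarrow> Some (Suc x) | _ \<Rightarrow> None)"
| "eval (Proj i) = (\<lambda>xs. if i < length xs then Some (xs ! i) else None)"
| "eval (Comp f gs) = (\<lambda>xs.
     let ys = map (\<lambda>h. h xs) (map eval gs)
     in if None \<in> set ys then None else eval f (map the ys))"
| "eval (Prec f g) = (\<lambda>xs. case xs of [] \<Rightarrow> None
     | n # ys \<Rightarrow>
         rec_nat (eval f ys) (\<lambda>i r. Option.bind r (\<lambda>v. eval g (i # v # ys))) n)"
| "eval (Mu f) = (\<lambda>xs.
     if \<exists>n. eval f (n # xs) = Some 0 \<and> (\<forall>i<n. \<exists>v. eval f (i # xs) = Some (Suc v))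
     then Some (LEAST n. eval f (n # xs) = Some 0)
     else None)"

primrec code :: "recf \<Rightarrow> nat" where
  "code Zero = prod_encode (0, 0)"
| "code Succ = prod_encode (1, 0)"
| "code (Proj i) = prod_encode (2, i)"
| "code (Comp f gs) = prod_encode (3, prod_encode (code f, list_encode (map code gs)))"
| "code (Prec f g) = prod_encode (4, prod_encode (code f, code g))"
| "code (Mu f) = prod_encode (5, code f)"

lemma code_inject: "code c = code d \<Longrightarrow> c = d"
proof (induction c arbitrary: d)
  case (Comp f gs)
  from Comp.prems obtain f' gs' where d: "d = Comp f' gs'" by (cases d) auto
  with Comp.prems have ff: "code f = code f'" and gg: "map code gs = map code gs'"
    by (auto simp: list_encode_eq)
  have "gs = gs'"
    using gg Comp.IH(2) by (induction gs arbitrary: gs') (auto simp: Cons_eq_map_conv)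
  with ff Comp.IH(1) d show ?case by blast
qed (case_tac d; auto)+

text \<open>
  \<open>app e x\<close> is the possibly undefined value \<open>ex\<close>. Numbers that are not the code of a program
  number the nowhere defined function.
\<close>

definition app :: "nat \<Rightarrow> nat \<Rightarrow> nat option" where
  "app e x = (if e \<in> range code then eval (inv code e) [x] else None)"

lemma app_code: "app (code c) x = eval c [x]"
proof -
  have "inj code" by (rule injI) (rule code_inject)
  then show ?thesis by (simp add: app_def)
qed

definition recursive_set :: "nat set \<Rightarrow> bool" where
  "recursive_set D \<longleftrightarrow> (\<exists>c. \<forall>n. eval c [n] = Some (indicator D n))"


section \<open>Operations on sets of numbers\<close>

abbreviation pair :: "nat \<Rightarrow> nat \<Rightarrow> nat" where
  "pair a b \<equiv> list_encode [a, b]"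

definition conj_set :: "nat set \<Rightarrow> nat set \<Rightarrow> nat set" where
  "conj_set A B = {pair a b |a b. a \<in> A \<and> b \<in> B}"

definition imp_set :: "nat set \<Rightarrow> nat set \<Rightarrow> nat set" where
  "imp_set A B = {e. \<forall>a\<in>A. \<exists>b\<in>B. app e a = Some b}"

definition reduces :: "(nat set \<Rightarrow> nat set) \<Rightarrow> (nat set \<Rightarrow> nat set) \<Rightarrow> bool" where
  "reduces f g \<longleftrightarrow> (\<Inter>p. imp_set (f p) (g p)) \<noteq> {}"

definition L :: "(nat set \<Rightarrow> nat set) \<Rightarrow> nat set \<Rightarrow> nat set" where
  "L g p = (\<Inter>q. imp_set (conj_set (imp_set p q) (imp_set (g q) q)) q)"

definition le_L :: "(nat set \<Rightarrow> nat set) \<Rightarrow> (nat set \<Rightarrow> nat set) \<Rightarrow> bool" where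
  "le_L f g \<longleftrightarrow> reduces f (L g)"

text \<open>\<open>G_map B \<theta>\<close> is $G_\theta$ for $\theta$ with domain \<open>B\<close>; \<open>G_fam \<A>\<close> is $G_{\cal A}$.\<close>

definition G_map :: "nat set \<Rightarrow> (nat \<Rightarrow> nat set set) \<Rightarrow> nat set \<Rightarrow> nat set" where
  "G_map B \<theta> p = {pair n e |n e. n \<in> B \<and> (\<exists>A\<in>\<theta> n. e \<in> imp_set A p)}"

definition G_fam :: "nat set set \<Rightarrow> nat set \<Rightarrow> nat set" where
  "G_fam \<A> p = (\<Union>A\<in>\<A>. imp_set A p)"

definition rho :: "nat set \<Rightarrow> nat \<Rightarrow> nat set set" where
  "rho D n = {{indicator D n}}"

text \<open>The identification of \<open>\<alpha> \<le> \<omega>\<close> with a set of numbers; \<open>\<infinity>\<close> plays the role of \<open>\<omega>\<close>.\<close>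

definition index_set :: "enat \<Rightarrow> nat set" where
  "index_set \<alpha> = {i. \<alpha> = \<infinity> \<or> 1 \<le> i \<and> enat i \<le> \<alpha>}"

lemma index_set_simps: "index_set (enat k) = {1..k}" "index_set \<infinity> = UNIV"
  by (auto simp: index_set_def)

text \<open>The finiteness condition is needed because \<open>card\<close> is 0 on infinite sets.\<close>

definition O_fam :: "enat \<Rightarrow> nat \<Rightarrow> nat set set" where
  "O_fam \<alpha> m =
     {X. X \<subseteq> index_set \<alpha> \<and> finite (index_set \<alpha> - X) \<and> card (index_set \<alpha> - X) = m}"

end

theory Submission
  imports Defs
begin

text \<open>
  Let $r$ realize the reduction and let $i$ be an index of the identity. Taking both $p$ and the
  quantified set $q$ to be $\{\chi_D(n)\}$, the number $r\langle n, i\rangle$ sends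
  $\langle i, b\rangle$ to $\chi_D(n)$ as soon as $b$ maps $G_{O^\alpha_m}(\{v\})$ to $\{v\}$
  for every $v$. An element $d$ of $G_{O^\alpha_m}(\{v\})$ takes the value $v$ on all but $m$
  indices, hence on at least $m + 1$ of the indices $1, \ldots, 2m + 1 \le \alpha$. So $b$ may run
  $d$ on these indices in parallel and return the first value found $m + 1$ times: two such
  majorities meet, so this is $v$. Running an index is itself recursive because there is a
  universal machine; of it only completeness is needed (it halts with the right value whenever
  the computation converges), since wrong or missing answers elsewhere cannot form a majority.
\<close>

section \<open>Computable total functions\<close>

definition computable :: "nat \<Rightarrow> (nat list \<Rightarrow> nat) \<Rightarrow> bool" where
  "computable n F \<longleftrightarrow> (\<exists>c. \<forall>xs. length xs = n \<longrightarrow> eval c xs = Some (F xs))"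

lemma computableI:
  assumes "\<And>xs. length xs = n \<Longrightarrow> eval c xs = Some (F xs)"
  shows "computable n F"
  using assms unfolding computable_def by blast

lemma computable_nth: "i < n \<Longrightarrow> computable n (\<lambda>xs. xs ! i)"
  by (rule computableI[where c = "Proj i"]) simp

lemma computable_Suc:
  assumes "computable n F"
  shows "computable n (\<lambda>xs. Suc (F xs))"
proof -
  obtain c where "\<And>xs. length xs = n \<Longrightarrow> eval c xs = Some (F xs)"
    using assms unfolding computable_def by blast
  then show ?thesis by (intro computableI[where c = "Comp Succ [c]"]) simp
qed

lemma computable_const: "computable n (\<lambda>xs. k)"
proof (induction k)
  case 0
  show ?case by (rule computableI[where c = Zero]) simp
next
  case (Suc k)
  then show ?case by (rule computable_Suc)
qed

lemma computable_comp1: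
  assumes "computable 1 (\<lambda>xs. h (xs ! 0))" "computable n F"
  shows "computable n (\<lambda>xs. h (F xs))"
proof -
  obtain c where c: "\<And>xs. length xs = 1 \<Longrightarrow> eval c xs = Some (h (xs ! 0))"
    using assms(1) unfolding computable_def by blast
  obtain f where "\<And>xs. length xs = n \<Longrightarrow> eval f xs = Some (F xs)"
    using assms(2) unfolding computable_def by blast
  then show ?thesis using c[of "[_]"] by (intro computableI[where c = "Comp c [f]"]) simp
qed

text \<open>\<open>S\<close> is the step on tuples and \<open>s\<close> its curried form, so that
  the conclusion fits \<open>rec_nat\<close>. As \<open>Prec\<close> recurses on its first argument,
  projections pass the whole tuple on as parameters.\<close>

lemma computable_rec:
  assumes "computable n N" "computable n B" "computable (Suc (Suc n)) S"
    and S: "\<And>i r xs. length xs = n \<Longrightarrow> S (i # r # xs) = s xs i r"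
  shows "computable n (\<lambda>xs. rec_nat (B xs) (s xs) (N xs))"
proof -
  obtain cN where cN: "\<And>xs. length xs = n \<Longrightarrow> eval cN xs = Some (N xs)"
    using assms(1) unfolding computable_def by blast
  obtain cB where cB: "\<And>xs. length xs = n \<Longrightarrow> eval cB xs = Some (B xs)"
    using assms(2) unfolding computable_def by blast
  obtain cS where cS: "\<And>xs. length xs = Suc (Suc n) \<Longrightarrow> eval cS xs = Some (S xs)"
    using assms(3) unfolding computable_def by blast
  show ?thesis
  proof (rule computableI[where c = "Comp (Prec cB cS) (cN # map Proj [0..<n])"])
    fix xs :: "nat list"
    assume l: "length xs = n"
    have "map (the \<circ> (\<lambda>h. h xs) \<circ> (eval \<circ> Proj)) [0..<n] = map ((!) xs) [0..<n]"
      by (rule map_cong) (use l in auto)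
    also have "\<dots> = xs"
      using l map_nth by blast
    finally have "eval (Comp (Prec cB cS) (cN # map Proj [0..<n])) xs
        = eval (Prec cB cS) (N xs # xs)"
      using l cN by (auto simp: Let_def o_assoc)
    moreover have "rec_nat (eval cB xs) (\<lambda>i r. Option.bind r (\<lambda>v. eval cS (i # v # xs))) k
        = Some (rec_nat (B xs) (s xs) k)" for k
      by (induction k) (use l cB cS S in auto)
    ultimately show "eval (Comp (Prec cB cS) (cN # map Proj [0..<n])) xs
        = Some (rec_nat (B xs) (s xs) (N xs))"
      by simp
  qed
qed

lemma computable_add:
  assumes "computable n F" "computable n G"
  shows "computable n (\<lambda>xs. F xs + G xs)"
proof -
  have "rec_nat b (\<lambda>i r. Suc r) a = a + b" for a b :: nat
    by (induction a) auto
  moreover have "computable n (\<lambda>xs. rec_nat (G xs) (\<lambda>i r. Suc r) (F xs))"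
    by (rule computable_rec[OF assms computable_Suc[OF computable_nth[of 1]]]) auto
  ultimately show ?thesis by simp
qed

lemma computable_pred:
  assumes "computable n F"
  shows "computable n (\<lambda>xs. F xs - 1)"
proof -
  have "rec_nat 0 (\<lambda>i r. i) a = a - 1" for a :: nat
    by (cases a) auto
  moreover have "computable n (\<lambda>xs. rec_nat 0 (\<lambda>i r. i) (F xs))"
    by (rule computable_rec[OF assms computable_const computable_nth[of 0]]) auto
  ultimately show ?thesis by simp
qed

lemma computable_diff:
  assumes "computable n F" "computable n G"
  shows "computable n (\<lambda>xs. F xs - G xs)"
proof -
  have "rec_nat a (\<lambda>i r. r - 1) b = a - b" for a b :: nat
    by (induction b) auto
  moreover have "computable n (\<lambda>xs. rec_nat (F xs) (\<lambda>i r. r - 1) (G xs))"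
    by (rule computable_rec[OF assms(2,1) computable_pred[OF computable_nth[of 1]]]) auto
  ultimately show ?thesis by simp
qed

text \<open>Lets a function ignore the extra leading arguments that recursion (two) and minimisation
  (one) put in front of the parameters.\<close>

lemma computable_drop:
  assumes "computable n F"
  shows "computable (d + n) (\<lambda>xs. F (drop d xs))"
proof -
  obtain c where c: "\<And>xs. length xs = n \<Longrightarrow> eval c xs = Some (F xs)"
    using assms unfolding computable_def by blast
  show ?thesis
  proof (rule computableI[where c = "Comp c (map Proj [d..<d + n])"])
    fix xs :: "nat list"
    assume l: "length xs = d + n"
    have "map (the \<circ> (\<lambda>h. h xs) \<circ> (eval \<circ> Proj)) [d..<d + n] = map ((!) xs) [d..<d + n]"
      by (rule map_cong) (use l in auto)
    also have "\<dots> = drop d xs"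
      using l by (intro nth_equalityI) auto
    finally show "eval (Comp c (map Proj [d..<d + n])) xs = Some (F (drop d xs))"
      using l c by (auto simp: Let_def o_assoc)
  qed
qed

lemma computable_if_le:
  assumes "computable n A" "computable n B" "computable n F" "computable n G"
  shows "computable n (\<lambda>xs. if A xs \<le> B xs then F xs else G xs)"
proof -
  \<comment> \<open>Case distinction by recursion: the count \<open>A xs - B xs\<close> is 0 exactly
    when \<open>A xs \<le> B xs\<close>.\<close>
  have "rec_nat (F xs) (\<lambda>i r. G xs) k = (if k = 0 then F xs else G xs)" for k xs
    by (cases k) auto
  moreover have "computable n (\<lambda>xs. rec_nat (F xs) (\<lambda>i r. G xs) (A xs - B xs))"
    by (rule computable_rec[OF computable_diff[OF assms(1,2)] assms(3)
          computable_drop[OF assms(4), of 2, simplified]]) auto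
  ultimately show ?thesis by simp
qed

lemma computable_if_eq:
  assumes "computable n A" "computable n B" "computable n F" "computable n G"
  shows "computable n (\<lambda>xs. if A xs = B xs then F xs else G xs)"
proof -
  have "computable n (\<lambda>xs. if A xs \<le> B xs then if B xs \<le> A xs then F xs else G xs else G xs)"
    by (intro computable_if_le assms)
  moreover have "(\<lambda>xs. if A xs \<le> B xs then if B xs \<le> A xs then F xs else G xs else G xs)
      = (\<lambda>xs. if A xs = B xs then F xs else G xs)"
    by auto
  ultimately show ?thesis by simp
qed

lemma computable_triangle:
  assumes "computable n F"
  shows "computable n (\<lambda>xs. triangle (F xs))"
proof -
  have "rec_nat 0 (\<lambda>i r. r + Suc i) a = triangle a" for a :: nat
    by (induction a) auto
  moreover have "computable n (\<lambda>xs. rec_nat 0 (\<lambda>i r. r + Suc i) (F xs))"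
    by (rule computable_rec[OF assms computable_const
          computable_add[OF computable_nth[of 1] computable_Suc[OF computable_nth[of 0]]]]) auto
  ultimately show ?thesis by simp
qed

section \<open>Coding and decoding of pairs and lists\<close>

abbreviation mk :: "nat \<Rightarrow> nat \<Rightarrow> nat" where
  "mk a b \<equiv> prod_encode (a, b)"

definition pfst :: "nat \<Rightarrow> nat" where
  "pfst z = fst (prod_decode z)"

definition psnd :: "nat \<Rightarrow> nat" where
  "psnd z = snd (prod_decode z)"

lemma pfst_mk [simp]: "pfst (mk a b) = a"
  by (simp add: pfst_def)

lemma psnd_mk [simp]: "psnd (mk a b) = b"
  by (simp add: psnd_def)

lemma computable_mk:
  assumes "computable n F" "computable n G"
  shows "computable n (\<lambda>xs. mk (F xs) (G xs))"
  unfolding prod_encode_def by (simp add: computable_add computable_triangle assms)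

text \<open>
  To decode a pair it suffices to compute its diagonal, which is the largest \<open>d\<close> with
  \<open>triangle d \<le> z\<close> and so can be updated from \<open>z\<close> to \<open>Suc z\<close>.
\<close>

definition diagonal :: "nat \<Rightarrow> nat" where
  "diagonal z = pfst z + psnd z"

lemma triangle_diagonal: "triangle (diagonal z) + pfst z = z"
proof -
  have "mk (pfst z) (psnd z) = z" by (simp add: pfst_def psnd_def)
  then show ?thesis by (simp add: prod_encode_def diagonal_def)
qed

lemma diagonal_le: "triangle (diagonal z) \<le> z"
  using triangle_diagonal[of z] by linarith

lemma diagonal_less: "z < triangle (Suc (diagonal z))"
proof -
  have "pfst z \<le> diagonal z" by (simp add: diagonal_def)
  then show ?thesis using triangle_diagonal[of z] by simp
qed

lemma triangle_mono: "a \<le> b \<Longrightarrow> triangle a \<le> triangle b"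
  by (induction b) (auto simp: le_Suc_eq)

text \<open>\<open>triangle\<close> is monotone, so the intervals between consecutive triangular
  numbers do not overlap.\<close>

lemma diagonal_unique:
  assumes "triangle d \<le> z" "z < triangle (Suc d)"
  shows "diagonal z = d"
proof (rule antisym)
  show "diagonal z \<le> d"
  proof (rule ccontr)
    assume "\<not> diagonal z \<le> d"
    then have "triangle (Suc d) \<le> triangle (diagonal z)" by (intro triangle_mono) simp
    then show False using diagonal_le[of z] assms by linarith
  qed
  show "d \<le> diagonal z"
  proof (rule ccontr)
    assume "\<not> d \<le> diagonal z"
    then have "triangle (Suc (diagonal z)) \<le> triangle d" by (intro triangle_mono) simp
    then show False using diagonal_less[of z] assms by linarith
  qed
qed

lemma diagonal_Suc:
  "diagonal (Suc z) = (if triangle (Suc (diagonal z)) \<le> Suc z then Suc (diagonal z) else diagonal z)"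
proof (cases "triangle (Suc (diagonal z)) \<le> Suc z")
  case True
  \<comment> \<open>Consecutive triangular numbers are far enough apart that one increment of
    \<open>z\<close> cannot skip a diagonal.\<close>
  moreover have "Suc z < triangle (Suc (Suc (diagonal z)))"
    using diagonal_less[of z] by simp
  ultimately show ?thesis using diagonal_unique[of "Suc (diagonal z)" "Suc z"] by (auto simp del: triangle_Suc)
next
  case False
  moreover have "triangle (diagonal z) \<le> Suc z"
    using diagonal_le[of z] by simp
  ultimately show ?thesis
    using diagonal_unique[of "diagonal z" "Suc z"] by (auto simp del: triangle_Suc)
qed

lemma computable_diagonal:
  assumes "computable n F"
  shows "computable n (\<lambda>xs. diagonal (F xs))"
proof -
  have "rec_nat 0 (\<lambda>i r. if triangle (Suc r) \<le> Suc i then Suc r else r) a = diagonal a" for a :: nat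
  proof (induction a)
    case 0
    show ?case using diagonal_unique[of 0 0] by simp
  next
    case (Suc a)
    then show ?case by (simp add: diagonal_Suc del: triangle_Suc)
  qed
  moreover have "computable n (\<lambda>xs. rec_nat 0
      (\<lambda>i r. if triangle (Suc r) \<le> Suc i then Suc r else r) (F xs))"
    by (rule computable_rec[OF assms computable_const, where S = "\<lambda>ys.
        if triangle (Suc (ys ! 1)) \<le> Suc (ys ! 0) then Suc (ys ! 1) else ys ! 1"])
      (auto intro!: computable_if_le computable_triangle computable_Suc computable_nth
        simp del: triangle_Suc)
  ultimately show ?thesis by simp
qed

lemma computable_pfst:
  assumes "computable n F"
  shows "computable n (\<lambda>xs. pfst (F xs))"
proof -
  have "pfst z = z - triangle (diagonal z)" for z
    using triangle_diagonal[of z] by linarith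
  then show ?thesis
    by (simp add: computable_diff computable_triangle computable_diagonal assms)
qed

lemma computable_psnd:
  assumes "computable n F"
  shows "computable n (\<lambda>xs. psnd (F xs))"
proof -
  have "psnd z = diagonal z - pfst z" for z
    by (simp add: diagonal_def)
  then show ?thesis
    by (simp add: computable_diff computable_pfst computable_diagonal assms)
qed

text \<open>This agrees with \<open>list_encode\<close>, where 0 codes the empty list, so the
  machine works directly on coded tuples.\<close>

abbreviation cons :: "nat \<Rightarrow> nat \<Rightarrow> nat" where
  "cons a l \<equiv> Suc (mk a l)"

abbreviation head :: "nat \<Rightarrow> nat" where
  "head l \<equiv> pfst (l - 1)"

abbreviation tail :: "nat \<Rightarrow> nat" where
  "tail l \<equiv> psnd (l - 1)"

lemmas computable_intros =
  computable_const computable_nth computable_Suc computable_pred computable_mk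
  computable_pfst computable_psnd computable_if_eq

section \<open>A universal abstract machine\<close>

text \<open>
  A state either evaluates program \<open>c\<close> on the coded tuple \<open>xs\<close> or returns \<open>v\<close>, in both cases to a
  continuation \<open>k\<close>. Continuations are nested pairs headed by a tag: 1 applies a program to the
  returned tuple, 2 is a pending step of a primitive recursion, 3 a pending test of a
  minimisation, and 4 and 5 collect a tuple of arguments from right to left. The tag 6, which
  \<open>code\<close> does not use, marks a list of programs to be evaluated to a tuple. The continuation 0,
  which is the pair \<open>(0, 0)\<close>, is empty, so that \<open>ret v 0\<close> is a fixed point.
\<close>

abbreviation evl :: "nat \<Rightarrow> nat \<Rightarrow> nat \<Rightarrow> nat" where
  "evl c xs k \<equiv> mk 0 (mk c (mk xs k))"

abbreviation ret :: "nat \<Rightarrow> nat \<Rightarrow> nat" where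
  "ret v k \<equiv> mk 1 (mk v k)"

text \<open>\<open>Proj\<close> walks down the tuple one entry per step; \<open>Prec\<close>
  evaluates itself at the predecessor and leaves the last step pending. Arities are not checked, so
  a tuple of unsuitable length may still yield a value.\<close>

definition step_evl :: "nat \<Rightarrow> nat \<Rightarrow> nat \<Rightarrow> nat" where
  "step_evl c xs k =
    (if pfst c = 0 then ret 0 k
     else if pfst c = 1 then ret (Suc (head xs)) k
     else if pfst c = 2 then
       if psnd c = 0 then ret (head xs) k else evl (mk 2 (psnd c - 1)) (tail xs) k
     else if pfst c = 3 then evl (mk 6 (psnd (psnd c))) xs (mk 1 (mk (pfst (psnd c)) k))
     else if pfst c = 4 then
       if head xs = 0 then evl (pfst (psnd c)) (tail xs) k
       else evl c (cons (head xs - 1) (tail xs))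
         (mk 2 (mk (psnd (psnd c)) (mk (head xs - 1) (mk (tail xs) k))))
     else if pfst c = 5 then evl (psnd c) (cons 0 xs) (mk 3 (mk (psnd c) (mk 0 (mk xs k))))
     else
       if psnd c = 0 then ret 0 k
       else evl (mk 6 (tail (psnd c))) xs (mk 4 (mk (head (psnd c)) (mk xs k))))"

definition step_ret :: "nat \<Rightarrow> nat \<Rightarrow> nat" where
  "step_ret v k =
    (if pfst k = 1 then evl (pfst (psnd k)) v (psnd (psnd k))
     else if pfst k = 2 then
       evl (pfst (psnd k))
         (cons (pfst (psnd (psnd k))) (cons v (pfst (psnd (psnd (psnd k))))))
         (psnd (psnd (psnd (psnd k))))
     else if pfst k = 3 then
       if v = 0 then ret (pfst (psnd (psnd k))) (psnd (psnd (psnd (psnd k))))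
       else evl (pfst (psnd k))
         (cons (Suc (pfst (psnd (psnd k)))) (pfst (psnd (psnd (psnd k)))))
         (mk 3 (mk (pfst (psnd k)) (mk (Suc (pfst (psnd (psnd k)))) (psnd (psnd (psnd k))))))
     else if pfst k = 4 then
       evl (pfst (psnd k)) (pfst (psnd (psnd k))) (mk 5 (mk v (psnd (psnd (psnd k)))))
     else if pfst k = 5 then ret (cons v (pfst (psnd k))) (psnd (psnd k))
     else ret v k)"

definition step :: "nat \<Rightarrow> nat" where
  "step s = (if pfst s = 0
     then step_evl (pfst (psnd s)) (pfst (psnd (psnd s))) (psnd (psnd (psnd s)))
     else step_ret (pfst (psnd s)) (psnd (psnd s)))"

lemma computable_step: "computable 1 (\<lambda>xs. step (xs ! 0))"
  unfolding step_def step_evl_def step_ret_def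
  by (intro computable_intros) simp_all

lemma computable_run:
  assumes "computable n T" "computable n F"
  shows "computable n (\<lambda>xs. (step ^^ T xs) (F xs))"
proof -
  have "rec_nat a (\<lambda>i. step) t = (step ^^ t) a" for a t
    by (induction t) auto
  moreover have "computable n (\<lambda>xs. rec_nat (F xs) (\<lambda>i. step) (T xs))"
    by (rule computable_rec[OF assms computable_comp1[OF computable_step computable_nth[of 1]]]) auto
  ultimately show ?thesis by simp
qed

section \<open>Completeness of the machine\<close>

definition reaches :: "nat \<Rightarrow> nat \<Rightarrow> bool" where
  "reaches s s' \<longleftrightarrow> (\<exists>t. (step ^^ t) s = s')"

lemma reaches_trans [trans]: "reaches s s' \<Longrightarrow> reaches s' s'' \<Longrightarrow> reaches s s''"
  unfolding reaches_def by (metis comp_apply funpow_add)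

lemma reaches_step: "step s = s' \<Longrightarrow> reaches s s'"
  unfolding reaches_def by (rule exI[of _ 1]) simp

lemma halted: "(step ^^ t) (ret v 0) = ret v 0"
proof (induction t)
  case (Suc t)
  have "pfst 0 = 0" using pfst_mk[of 0 0] by (simp add: prod_encode_def)
  then show ?case using Suc by (simp add: step_def step_ret_def)
qed simp

lemma reaches_Proj:
  "i < length xs \<Longrightarrow> reaches (evl (mk 2 i) (list_encode xs) k) (ret (xs ! i) k)"
proof (induction xs arbitrary: i)
  case (Cons x xs)
  show ?case
  proof (cases i)
    case 0
    then show ?thesis by (intro reaches_step) (simp add: step_def step_evl_def)
  next
    case (Suc j)
    then have "reaches (evl (mk 2 i) (list_encode (x # xs)) k) (evl (mk 2 j) (list_encode xs) k)"
      by (intro reaches_step) (simp add: step_def step_evl_def)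
    also have "reaches \<dots> (ret ((x # xs) ! i) k)"
      using Cons Suc by simp
    finally show ?thesis .
  qed
qed simp

text \<open>The tail is evaluated before the head, so each new value is consed onto the finished
  rest. The first assumption is what the induction in \<open>reaches_eval\<close> supplies for the
  inner programs of a composition.\<close>

lemma reaches_list:
  assumes "\<And>g v k. g \<in> set gs \<Longrightarrow> eval g xs = Some v \<Longrightarrow>
      reaches (evl (code g) (list_encode xs) k) (ret v k)"
    and "map (\<lambda>g. eval g xs) gs = map Some ys"
  shows "reaches (evl (mk 6 (list_encode (map code gs))) (list_encode xs) k)
      (ret (list_encode ys) k)"
  using assms
proof (induction gs arbitrary: ys k)
  case Nil
  then show ?case by (intro reaches_step) (simp add: step_def step_evl_def)
next
  case (Cons g gs)
  then obtain y zs where ys: "ys = y # zs" by (cases ys) auto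
  let ?xs = "list_encode xs"
  have "reaches (evl (mk 6 (list_encode (map code (g # gs)))) ?xs k)
      (evl (mk 6 (list_encode (map code gs))) ?xs (mk 4 (mk (code g) (mk ?xs k))))"
    by (intro reaches_step) (simp add: step_def step_evl_def)
  also have "reaches \<dots> (ret (list_encode zs) (mk 4 (mk (code g) (mk ?xs k))))"
    using Cons ys by auto
  also have "reaches \<dots> (evl (code g) ?xs (mk 5 (mk (list_encode zs) k)))"
    by (intro reaches_step) (simp add: step_def step_ret_def)
  also have "reaches \<dots> (ret y (mk 5 (mk (list_encode zs) k)))"
    using Cons ys by auto
  also have "reaches \<dots> (ret (list_encode ys) k)"
    by (intro reaches_step) (simp add: step_def step_ret_def ys)
  finally show ?case .
qed

text \<open>Structural induction on the program, for all continuations \<open>k\<close>, since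
  subprograms run under longer ones.\<close>

lemma reaches_eval:
  "eval c xs = Some v \<Longrightarrow> reaches (evl (code c) (list_encode xs) k) (ret v k)"
proof (induction c arbitrary: xs v k)
  case Zero
  then show ?case by (intro reaches_step) (simp add: step_def step_evl_def)
next
  case Succ
  then show ?case
    by (intro reaches_step) (auto simp: step_def step_evl_def split: list.splits)
next
  case (Proj i)
  then show ?case
    by (auto split: if_splits intro: reaches_Proj simp del: One_nat_def)
next
  case (Comp f gs)
  define ys where "ys = map (\<lambda>g. the (eval g xs)) gs"
  have none: "None \<notin> set (map (\<lambda>g. eval g xs) gs)" and v: "eval f ys = Some v"
    using Comp.prems by (auto simp: Let_def o_def ys_def split: if_splits)
  have ys: "map (\<lambda>g. eval g xs) gs = map Some ys"
    using none by (force simp: ys_def image_iff)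
  let ?k = "mk 1 (mk (code f) k)"
  have "reaches (evl (code (Comp f gs)) (list_encode xs) k)
      (evl (mk 6 (list_encode (map code gs))) (list_encode xs) ?k)"
    by (intro reaches_step) (simp add: step_def step_evl_def)
  also have "reaches \<dots> (ret (list_encode ys) ?k)"
    using ys Comp.IH(2) by (intro reaches_list) auto
  also have "reaches \<dots> (evl (code f) (list_encode ys) k)"
    by (intro reaches_step) (simp add: step_def step_ret_def)
  also have "reaches \<dots> (ret v k)"
    using Comp.IH(1) v by blast
  finally show ?case .
next
  case (Prec f g)
  then obtain n ys where xs: "xs = n # ys" by (cases xs) auto
  \<comment> \<open>An inner induction on the recursion argument; \<open>k\<close> stays general
    because the call at the predecessor has a pending step.\<close>
  have "eval (Prec f g) (n # ys) = Some v \<Longrightarrow>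
      reaches (evl (code (Prec f g)) (list_encode (n # ys)) k) (ret v k)"
  proof (induction n arbitrary: v k)
    case 0
    have "reaches (evl (code (Prec f g)) (list_encode (0 # ys)) k) (evl (code f) (list_encode ys) k)"
      by (intro reaches_step) (simp add: step_def step_evl_def)
    also have "reaches \<dots> (ret v k)"
      using Prec.IH(1) 0 by simp
    finally show ?case .
  next
    case (Suc n)
    then obtain u where u: "eval (Prec f g) (n # ys) = Some u"
      and v: "eval g (n # u # ys) = Some v"
      by (auto split: bind_splits)
    let ?k = "mk 2 (mk (code g) (mk n (mk (list_encode ys) k)))"
    have "reaches (evl (code (Prec f g)) (list_encode (Suc n # ys)) k)
        (evl (code (Prec f g)) (list_encode (n # ys)) ?k)"
      by (intro reaches_step) (simp add: step_def step_evl_def)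
    also have "reaches \<dots> (ret u ?k)"
      using Suc.IH u by blast
    also have "reaches \<dots> (evl (code g) (list_encode (n # u # ys)) k)"
      by (intro reaches_step) (simp add: step_def step_ret_def)
    also have "reaches \<dots> (ret v k)"
      using Prec.IH(2) v by blast
    finally show ?case .
  qed
  then show ?case using Prec.prems xs by blast
next
  case (Mu f)
  let ?P = "\<lambda>n. eval f (n # xs) = Some 0"
  have ex: "\<exists>n. ?P n \<and> (\<forall>i<n. \<exists>u. eval f (i # xs) = Some (Suc u))"
    and v: "v = (LEAST n. ?P n)"
    using Mu.prems by (auto split: if_splits)
  from ex obtain n where n: "?P n" and below: "\<And>i. i < n \<Longrightarrow> \<exists>u. eval f (i # xs) = Some (Suc u)"
    by blast
  have "v = n" unfolding v
  proof (rule Least_equality)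
    fix j assume "?P j"
    then show "n \<le> j" using below[of j] by (cases "j < n") auto
  qed (rule n)
  let ?k = "\<lambda>i. mk 3 (mk (code f) (mk i (mk (list_encode xs) k)))"
  \<comment> \<open>Loop invariant of the search: round \<open>i\<close> evaluates \<open>f\<close>
    at \<open>i\<close> with its test pending, and all values before round \<open>n\<close> are
    successors.\<close>
  have "i \<le> n \<Longrightarrow> reaches (evl (code (Mu f)) (list_encode xs) k)
      (evl (code f) (list_encode (i # xs)) (?k i))" for i
  proof (induction i)
    case 0
    show ?case by (intro reaches_step) (simp add: step_def step_evl_def)
  next
    case (Suc i)
    then obtain u where u: "eval f (i # xs) = Some (Suc u)" using below[of i] by auto
    have "reaches (evl (code (Mu f)) (list_encode xs) k)
        (evl (code f) (list_encode (i # xs)) (?k i))"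
      using Suc by simp
    also have "reaches \<dots> (ret (Suc u) (?k i))"
      using Mu.IH u by blast
    also have "reaches \<dots> (evl (code f) (list_encode (Suc i # xs)) (?k (Suc i)))"
      by (intro reaches_step) (simp add: step_def step_ret_def)
    finally show ?case .
  qed
  then have "reaches (evl (code (Mu f)) (list_encode xs) k)
      (evl (code f) (list_encode (n # xs)) (?k n))"
    by simp
  also have "reaches \<dots> (ret 0 (?k n))"
    using Mu.IH n by blast
  also have "reaches \<dots> (ret v k)"
    by (intro reaches_step) (simp add: step_def step_ret_def \<open>v = n\<close>)
  finally show ?case .
qed

section \<open>Halting within a time bound\<close>

definition halts_by :: "nat \<Rightarrow> nat \<Rightarrow> nat \<Rightarrow> nat \<Rightarrow> bool" where
  "halts_by t e x v \<longleftrightarrow> (step ^^ t) (evl e (cons x 0) 0) = ret v 0"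

lemma halts_by_mono:
  assumes "halts_by t e x v" "t \<le> t'"
  shows "halts_by t' e x v"
proof -
  have "(step ^^ t') (evl e (cons x 0) 0) = (step ^^ (t' - t)) ((step ^^ t) (evl e (cons x 0) 0))"
    using assms(2) by (metis comp_apply funpow_add le_add_diff_inverse2)
  then show ?thesis using assms(1) halted by (simp add: halts_by_def)
qed

text \<open>Halted states are fixed points, so both runs agree at the later time. This holds for
  every number \<open>e\<close>, code or not.\<close>

lemma halts_by_unique:
  assumes "halts_by t e x v" "halts_by t' e x v'"
  shows "v = v'"
proof -
  have "halts_by (max t t') e x v" "halts_by (max t t') e x v'"
    using assms by (auto intro: halts_by_mono)
  then show ?thesis by (simp add: halts_by_def)
qed

lemma app_SomeE:
  assumes "app e x = Some v"
  obtains c where "e = code c" "eval c [x] = Some v"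
  using assms app_code by (metis app_def imageE option.distinct(1))

lemma app_halts:
  assumes "app e x = Some v"
  obtains t where "halts_by t e x v"
proof -
  obtain c where c: "e = code c" "eval c [x] = Some v"
    using assms by (rule app_SomeE)
  then show ?thesis
    using reaches_eval[of c "[x]" v 0] that by (auto simp: reaches_def halts_by_def)
qed

lemma computable_if_halts:
  assumes "computable n T" "computable n E" "computable n X" "computable n V"
  shows "computable n (\<lambda>xs. if halts_by (T xs) (E xs) (X xs) (V xs) then 1 else 0)"
  unfolding halts_by_def by (intro computable_intros computable_run assms)

section \<open>Majority votes of computations\<close>

lemma computable_card:
  assumes "finite I" "\<And>i. i \<in> I \<Longrightarrow> computable n (\<lambda>xs. if P i xs then 1 else 0)"
  shows "computable n (\<lambda>xs. card {i \<in> I. P i xs})"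
proof -
  have "card {i \<in> I. P i xs} = (\<Sum>i\<in>I. if P i xs then 1 else 0)" for xs
    using assms(1) by (simp add: sum.If_cases Int_def)
  moreover have "computable n (\<lambda>xs. \<Sum>i\<in>I. if P i xs then 1 else 0)"
    using assms by (induction I rule: finite_induct) (auto intro: computable_const computable_add)
  ultimately show ?thesis by simp
qed

lemma eval_Mu:
  assumes "\<And>n. eval f (n # xs) = Some (F n)" "F n = 0"
  shows "\<exists>k. eval (Mu f) xs = Some k \<and> F k = 0"
proof -
  define k where "k = (LEAST k. F k = 0)"
  have "F k = 0" unfolding k_def by (rule LeastI[of _ n]) (rule assms(2))
  moreover have "\<exists>v. F i = Suc v" if "i < k" for i
    using not_less_Least[of i "\<lambda>k. F k = 0"] that by (auto simp: k_def not0_implies_Suc)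
  ultimately have "\<exists>n. F n = 0 \<and> (\<forall>i<n. \<exists>v. F i = Suc v)" by blast
  then have "eval (Mu f) xs = Some k" by (simp add: assms(1) k_def)
  with \<open>F k = 0\<close> show ?thesis by blast
qed

text \<open>Search for a time and a value on which more than \<open>m\<close> indices agree. Since
  \<open>card I \<le> 2 * m + 1\<close>, any two such sets of indices meet, so whatever the search
  finds is the right value.\<close>

lemma majority_program:
  assumes fin: "finite I" and card_I: "card I \<le> 2 * m + 1"
    and E: "computable n E" and X: "\<And>i. i \<in> I \<Longrightarrow> computable n (X i)"
  shows "\<exists>c. \<forall>xs v. length xs = n \<longrightarrow> m < card {i \<in> I. app (E xs) (X i xs) = Some v} \<longrightarrow>
      eval c xs = Some v"
proof -
  \<comment> \<open>The single search variable \<open>w\<close> codes a time bound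
    \<open>pfst w\<close> and a candidate value \<open>psnd w\<close>.\<close>
  define votes where
    "votes w xs = {i \<in> I. halts_by (pfst w) (E xs) (X i xs) (psnd w)}" for w xs
  have drop1: "computable (Suc n) (\<lambda>ys. F (drop 1 ys))" if "computable n F" for F
    using computable_drop[OF that, of 1] by simp
  have "computable (Suc n) (\<lambda>ys. card {i \<in> I.
      halts_by (pfst (ys ! 0)) (E (drop 1 ys)) (X i (drop 1 ys)) (psnd (ys ! 0))})"
    by (intro computable_card computable_if_halts computable_pfst computable_psnd drop1 fin E X
        computable_nth) auto
  \<comment> \<open>Truncated subtraction: the result is 0 exactly when more than \<open>m\<close>
    indices vote for the candidate.\<close>
  then have "computable (Suc n) (\<lambda>ys. Suc m - card (votes (ys ! 0) (drop 1 ys)))"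
    unfolding votes_def by (intro computable_diff computable_const)
  then obtain f where "\<And>ys. length ys = Suc n \<Longrightarrow>
      eval f ys = Some (Suc m - card (votes (ys ! 0) (drop 1 ys)))"
    unfolding computable_def by blast
  then have f: "eval f (w # xs) = Some (Suc m - card (votes w xs))" if "length xs = n" for w xs
    using that by simp
  have "computable 1 (\<lambda>ys. psnd (ys ! 0))"
    by (intro computable_intros) simp
  then obtain g where "\<And>ys. length ys = 1 \<Longrightarrow> eval g ys = Some (psnd (ys ! 0))"
    unfolding computable_def by blast
  then have g: "eval g [w] = Some (psnd w)" for w
    by simp
  show ?thesis
  proof (intro exI[of _ "Comp g [Mu f]"] allI impI)
    fix xs v
    assume l: "length xs = n" and maj: "m < card {i \<in> I. app (E xs) (X i xs) = Some v}"
    let ?A = "{i \<in> I. app (E xs) (X i xs) = Some v}"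
    have "\<forall>i\<in>?A. \<exists>t. halts_by t (E xs) (X i xs) v"
      using app_halts by blast
    then obtain t where t: "\<And>i. i \<in> ?A \<Longrightarrow> halts_by (t i) (E xs) (X i xs) v"
      by metis
    have fin_A: "finite ?A" using fin by simp
    \<comment> \<open>The sum of the halting times serves as a common time bound, so the search
      succeeds.\<close>
    have "halts_by (sum t ?A) (E xs) (X i xs) v" if "i \<in> ?A" for i
      using t[OF that] by (rule halts_by_mono) (rule member_le_sum[OF that _ fin_A], simp)
    then have "?A \<subseteq> votes (mk (sum t ?A) v) xs"
      by (auto simp: votes_def)
    then have "card ?A \<le> card (votes (mk (sum t ?A) v) xs)"
      by (rule card_mono[rotated]) (simp add: votes_def fin)
    then have "Suc m - card (votes (mk (sum t ?A) v) xs) = 0"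
      using maj by simp
    then obtain w where w: "eval (Mu f) xs = Some w" and "Suc m - card (votes w xs) = 0"
      using eval_Mu[of f xs, OF f[OF l]] by blast
    \<comment> \<open>The \<open>w\<close> found need not be the one constructed above; counting
      yields an index at which both values are reached.\<close>
    then have "2 * m + 1 < card ?A + card (votes w xs)"
      using maj by simp
    moreover have "card (?A \<union> votes w xs) \<le> card I"
      by (rule card_mono[OF fin]) (auto simp: votes_def)
    moreover have "card ?A + card (votes w xs) = card (?A \<union> votes w xs) + card (?A \<inter> votes w xs)"
      by (rule card_Un_Int) (auto simp: votes_def fin)
    ultimately have "?A \<inter> votes w xs \<noteq> {}"
      using card_I by auto
    then obtain i where i: "i \<in> ?A" "i \<in> votes w xs" by blast
    then have "v = psnd w"
      using t[OF i(1)] halts_by_unique by (auto simp: votes_def)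
    then show "eval (Comp g [Mu f]) xs = Some v"
      using w g by simp
  qed
qed

text \<open>A majority vote with \<open>m = 0\<close> over one dummy index.\<close>

lemma universal_program: "\<exists>u. \<forall>e x v. app e x = Some v \<longrightarrow> eval u [e, x] = Some v"
proof -
  have "\<exists>u. \<forall>xs v. length xs = 2 \<longrightarrow>
      0 < card {i \<in> {0::nat}. app (xs ! 0) (xs ! 1) = Some v} \<longrightarrow> eval u xs = Some v"
    by (rule majority_program) (simp_all add: computable_nth)
  then obtain u where u: "\<And>xs v. length xs = 2 \<Longrightarrow>
      0 < card {i \<in> {0::nat}. app (xs ! 0) (xs ! 1) = Some v} \<Longrightarrow> eval u xs = Some v"
    by blast
  have "eval u [e, x] = Some v" if "app e x = Some v" for e x v
    using u[of "[e, x]" v] that by simp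
  then show ?thesis by blast
qed

section \<open>Application to the reduction\<close>

lemma majority_realizer:
  assumes "enat (2 * m) < \<alpha>"
  shows "\<exists>b. \<forall>v. code b \<in> imp_set (G_fam (O_fam \<alpha> m) {v}) {v}"
proof -
  let ?I = "{1..2 * m + 1}"
  have "\<exists>b. \<forall>xs v. length xs = 1 \<longrightarrow>
      m < card {i \<in> ?I. app (xs ! 0) i = Some v} \<longrightarrow> eval b xs = Some v"
    by (rule majority_program) (simp_all add: computable_nth computable_const)
  then obtain b where b: "\<And>xs v. length xs = 1 \<Longrightarrow>
      m < card {i \<in> ?I. app (xs ! 0) i = Some v} \<Longrightarrow> eval b xs = Some v"
    by blast
  have I: "?I \<subseteq> index_set \<alpha>"
    using assms by (cases \<alpha>) (auto simp: index_set_simps)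
  have "code b \<in> imp_set (G_fam (O_fam \<alpha> m) {v}) {v}" for v
  proof -
    have "app (code b) d = Some v" if mem: "d \<in> G_fam (O_fam \<alpha> m) {v}" for d
    proof -
      obtain A where A: "A \<in> O_fam \<alpha> m" and d: "d \<in> imp_set A {v}"
        using mem unfolding G_fam_def by blast
      have co: "finite (index_set \<alpha> - A)" "card (index_set \<alpha> - A) = m"
        using A by (auto simp: O_fam_def)
      \<comment> \<open>Each of the \<open>2 * m + 1\<close> indices either gives \<open>v\<close>
        or is one of the \<open>m\<close> indices outside \<open>A\<close>.\<close>
      have "card ?I \<le> card ({i \<in> ?I. app d i = Some v} \<union> (index_set \<alpha> - A))"
        by (rule card_mono) (use co d I in \<open>auto simp: imp_set_def\<close>)
      also have "\<dots> \<le> card {i \<in> ?I. app d i = Some v} + m"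
        using card_Un_le[of "{i \<in> ?I. app d i = Some v}" "index_set \<alpha> - A"] by (simp only: co(2))
      finally have "m < card {i \<in> ?I. app d i = Some v}" by simp
      then show ?thesis using b[of "[d]" v] by (simp add: app_code)
    qed
    then show ?thesis by (simp add: imp_set_def)
  qed
  then show ?thesis by blast
qed

theorem theorem5p9:
  fixes D :: "nat set" and m :: nat and \<alpha> :: enat
  assumes "m \<ge> 1"
    and "1 < 2 * m" and "enat (2 * m) < \<alpha>" and "\<alpha> \<le> \<infinity>"
    and "le_L (G_map UNIV (rho D)) (G_fam (O_fam \<alpha> m))"
  shows "recursive_set D"
proof -
  let ?\<chi> = "indicator D :: nat \<Rightarrow> nat"
  let ?i = "code (Proj 0)"
  obtain b where b: "\<And>v. code b \<in> imp_set (G_fam (O_fam \<alpha> m) {v}) {v}"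
    using majority_realizer[OF assms(3)] by blast
  obtain r where r: "\<And>p. r \<in> imp_set (G_map UNIV (rho D) p) (L (G_fam (O_fam \<alpha> m)) p)"
    using assms(5) by (auto simp: le_L_def reduces_def)
  have id: "?i \<in> imp_set {v} {v}" for v
    by (simp add: imp_set_def app_code del: code.simps)
  have *: "\<exists>s. app r (pair n ?i) = Some s \<and> app s (pair ?i (code b)) = Some (?\<chi> n)" for n
  proof -
    have "pair n ?i \<in> G_map UNIV (rho D) {?\<chi> n}"
      using id[of "?\<chi> n"] by (auto simp: G_map_def rho_def)
    then obtain s where s: "app r (pair n ?i) = Some s" "s \<in> L (G_fam (O_fam \<alpha> m)) {?\<chi> n}"
      using r[of "{?\<chi> n}"] unfolding imp_set_def by blast
    have "pair ?i (code b) \<in> conj_set (imp_set {?\<chi> n} {?\<chi> n})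
        (imp_set (G_fam (O_fam \<alpha> m) {?\<chi> n}) {?\<chi> n})"
      using id b unfolding conj_set_def by blast
    \<comment> \<open>The intersection defining \<open>L\<close> is used at \<open>q = p\<close>,
      where the identity realizes the first component.\<close>
    moreover have "s \<in> imp_set (conj_set (imp_set {?\<chi> n} {?\<chi> n})
        (imp_set (G_fam (O_fam \<alpha> m) {?\<chi> n}) {?\<chi> n})) {?\<chi> n}"
      using s(2) unfolding L_def by blast
    ultimately have "app s (pair ?i (code b)) = Some (?\<chi> n)"
      unfolding imp_set_def by blast
    with s(1) show ?thesis by blast
  qed
  \<comment> \<open>By \<open>*\<close>, \<open>r\<close> converges somewhere, so it is the code of
    a program.\<close>
  then obtain c where c: "r = code c"
    using app_SomeE by metis
  obtain u where u: "\<And>e x v. app e x = Some v \<Longrightarrow> eval u [e, x] = Some v"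
    using universal_program by blast
  have "computable 1 (\<lambda>xs. pair (xs ! 0) ?i)"
    unfolding list_encode.simps by (intro computable_intros) simp
  then obtain h where h: "\<And>n. eval h [n] = Some (pair n ?i)"
    unfolding computable_def by (metis length_Cons list.size(3) One_nat_def nth_Cons_0)
  obtain k where k: "\<And>n. eval k [n] = Some (pair ?i (code b))"
    using computable_const[of 1 "pair ?i (code b)"]
    unfolding computable_def by (metis length_Cons list.size(3) One_nat_def)
  \<comment> \<open>The index \<open>s\<close> computed by \<open>c\<close> depends on
    \<open>n\<close>, so the universal program \<open>u\<close> has to run it.\<close>
  have "eval (Comp u [Comp c [h], k]) [n] = Some (?\<chi> n)" for n
    using *[of n] h k u by (auto simp: c app_code Let_def)
  then show ?thesis
    unfolding recursive_set_def by blast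
qed

end
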